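(* Let $n,m\ge 1$, $p\ge 0$, and let $P\in\mathbb{R}^{n\times n}$ be symmetric, $q\in\mathbb{R}^n$, $N\in\mathbb{R}^{n\times m}$, $A\in\mathbb{R}^{p\times n}$, $M\in\mathbb{R}^{p\times m}$, $b\in\mathbb{R}^p$. For $u\in\mathbb{R}^m$ consider the open quadratic program $$\min_{x\in\mathbb{R}^n}\ \tfrac12 x^{\mathsf T}Px+(q+Nu)^{\mathsf T}x\quad\text{s.t.}\quad Ax+Mu=b,$$ with KKT matrix $K=\begin{bmatrix} P & A^{\mathsf T} \\ A & 0 \end{bmatrix}$ and behavior $\mathcal{B}=\{(u,x)\in\mathbb{R}^m\times\mathbb{R}^n\mid x\in X^\star(u)\}$, where $X^\star(u)$ is the set of minimizers of the program for the input $u$. Assume that $P\succeq 0$ and that $K$ is nonsingular. Then $\mathcal{B}$ is an affine subspace of $\mathbb{R}^m\times\mathbb{R}^n$ of dimension $m$.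
   Context: The parameter $u\in\mathbb{R}^m$ is called the input and $x\in\mathbb{R}^n$ the decision variable. The behavior of the program is the graph of its solution map $u\mapsto X^\star(u)=\arg\min\{\tfrac12 x^{\mathsf T}Px+(q+Nu)^{\mathsf T}x : x\in\mathbb{R}^n,\ Ax+Mu=b\}$. If there are no constraints ($p=0$), then $K=P$. *)

theory Defs
  imports "Jordan_Normal_Form.VS_Connect"
begin

text \<open>Vectors and matrices are those of Jordan_Normal_Form, whose dimensions are natural numbers
  and may be \<open>0\<close>; a program without constraints is the case \<open>p = 0\<close>.\<close>

definition pos_semidef :: "nat \<Rightarrow> real mat \<Rightarrow> bool" where
  "pos_semidef n P \<longleftrightarrow> P \<in> carrier_mat n n \<and> transpose_mat P = P \<and>
     (\<forall>x \<in> carrier_vec n. 0 \<le> x \<bullet> (P *\<^sub>v x))"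

definition qp_objective ::
    "real mat \<Rightarrow> real vec \<Rightarrow> real mat \<Rightarrow> real vec \<Rightarrow> real vec \<Rightarrow> real" where
  "qp_objective P q N u x = 1 / 2 * (x \<bullet> (P *\<^sub>v x)) + (q + N *\<^sub>v u) \<bullet> x"

definition qp_solutions ::
    "nat \<Rightarrow> real mat \<Rightarrow> real vec \<Rightarrow> real mat \<Rightarrow> real mat \<Rightarrow> real mat \<Rightarrow> real vec \<Rightarrow>
     real vec \<Rightarrow> real vec set" where
  "qp_solutions n P q N A M b u =
     {x. is_arg_min (qp_objective P q N u)
           (\<lambda>x. x \<in> carrier_vec n \<and> A *\<^sub>v x + M *\<^sub>v u = b) x}"

definition qp_behavior ::
    "nat \<Rightarrow> nat \<Rightarrow> real mat \<Rightarrow> real vec \<Rightarrow> real mat \<Rightarrow> real mat \<Rightarrow> real mat \<Rightarrow> real vec \<Rightarrow>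
     (real vec \<times> real vec) set" where
  "qp_behavior m n P q N A M b =
     {(u, x). u \<in> carrier_vec m \<and> x \<in> carrier_vec n \<and> x \<in> qp_solutions n P q N A M b u}"

definition kkt_mat :: "nat \<Rightarrow> real mat \<Rightarrow> real mat \<Rightarrow> real mat" where
  "kkt_mat p P A = four_block_mat P (transpose_mat A) A (0\<^sub>m p p)"

text \<open>In particular an affine subspace is nonempty. The requirement \<^const>\<open>vectorspace.fin_dim\<close>
  is needed because \<^const>\<open>vectorspace.dim\<close> is an unspecified number when there is no finite
  spanning set.\<close>

definition affine_subspace_of_dim ::
    "('k, 'r) ring_scheme \<Rightarrow> ('k, 'v, 's) module_scheme \<Rightarrow> 'v set \<Rightarrow> nat \<Rightarrow> bool" where
  "affine_subspace_of_dim K V S d \<longleftrightarrow>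
     (\<exists>a W. a \<in> carrier V \<and> subspace K W V \<and> S = (\<lambda>w. a \<oplus>\<^bsub>V\<^esub> w) ` W \<and>
        vectorspace.fin_dim K (V\<lparr>carrier := W\<rparr>) \<and> vectorspace.dim K (V\<lparr>carrier := W\<rparr>) = d)"

abbreviation real_vec_prod :: "nat \<Rightarrow> nat \<Rightarrow> (real, real vec \<times> real vec) module" where
  "real_vec_prod m n \<equiv> direct_sum (module_vec TYPE(real) m) (module_vec TYPE(real) n)"

end

theory Submission
  imports Defs
begin

text \<open>Because \<open>K\<close> is nonsingular, the KKT system has exactly one solution \<open>(x, l)\<close> for each input \<open>u\<close>,
  and \<open>x\<close> is an affine function of \<open>u\<close>. Along a feasible direction \<open>d\<close> (that is, \<open>A d = 0\<close>) the
  objective grows from \<open>x\<close> by exactly \<open>d\<^sup>T P d / 2\<close>. Hence \<open>x\<close> is a minimizer; and any other one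
  differs from it by some \<open>d\<close> with \<open>d\<^sup>T P d = 0\<close>, so \<open>P d = 0\<close> by semidefiniteness,
  so \<open>K (d, 0) = 0\<close>, so \<open>d = 0\<close>. The behavior is therefore the graph of an affine map on \<open>\<real>\<^sup>m\<close>.\<close>

section \<open>Zeros of a semidefinite quadratic form\<close>

text \<open>Moving from \<open>x\<close> in the direction \<open>y = P x\<close> by
  \<open>t\<close>, the form takes the value 2 t |y|^2 + t^2 c. This polynomial has no constant term
  and is nonnegative for all real t, so its linear coefficient must vanish, which forces y =
  0.\<close>

lemma pos_semidef_quadratic_form_zero:
  assumes "pos_semidef n P" and x: "x \<in> carrier_vec n" and zero: "x \<bullet> (P *\<^sub>v x) = 0"
  shows "P *\<^sub>v x = 0\<^sub>v n"
proof -
  from assms have P: "P \<in> carrier_mat n n" and sym: "transpose_mat P = P"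
    and psd: "\<And>v. v \<in> carrier_vec n \<Longrightarrow> 0 \<le> v \<bullet> (P *\<^sub>v v)"
    by (auto simp: pos_semidef_def)
  define y where "y = P *\<^sub>v x"
  have y: "y \<in> carrier_vec n" using P x by (simp add: y_def)
  define s c where "s = y \<bullet> y" and "c = y \<bullet> (P *\<^sub>v y)"
  have xPy: "x \<bullet> (P *\<^sub>v y) = s"
    using transpose_vec_mult_scalar[OF P y x] sym by (simp add: s_def y_def)
  have quad: "0 \<le> 2 * t * s + t\<^sup>2 * c" for t :: real
  proof -
    have "0 \<le> (x + t \<cdot>\<^sub>v y) \<bullet> (P *\<^sub>v (x + t \<cdot>\<^sub>v y))"
      using psd x y by simp
    also have "P *\<^sub>v (x + t \<cdot>\<^sub>v y) = y + t \<cdot>\<^sub>v (P *\<^sub>v y)"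
      using P x y by (simp add: mult_add_distrib_mat_vec[OF P x] mult_mat_vec[OF P] y_def)
    also have "(x + t \<cdot>\<^sub>v y) \<bullet> (y + t \<cdot>\<^sub>v (P *\<^sub>v y)) = 2 * t * s + t\<^sup>2 * c"
      using P x y zero xPy
      by (simp add: add_scalar_prod_distrib[of _ n] scalar_prod_add_distrib[of _ n]
            s_def[symmetric] c_def[symmetric] y_def[symmetric] power2_eq_square algebra_simps)
    finally show ?thesis .
  qed
  have "s = 0"
  proof (rule ccontr)
    assume "s \<noteq> 0"
    moreover have "0 \<le> s" by (simp add: s_def scalar_prod_def sum_nonneg)
    ultimately have s: "0 < s" by simp
    have c: "0 \<le> c" using psd[OF y] by (simp add: c_def)
    \<comment> \<open>A small negative step \<open>t = - s / k\<close> would make the polynomial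
      negative. Any positive \<open>k\<close> above \<open>c / 2\<close> would serve;
      \<open>c + 1\<close> is also safe when \<open>c = 0\<close>.\<close>
    define k where "k = c + 1"
    have k: "0 < k" "c = k - 1" using c by (simp_all add: k_def)
    have "2 * (- s / k) * s + (- s / k)\<^sup>2 * c = - (s\<^sup>2 * (k + 1) / k\<^sup>2)"
      using k by (simp add: divide_simps power2_eq_square) (simp add: algebra_simps)
    also have "\<dots> < 0" using s k by simp
    finally show False using quad[of "- s / k"] by simp
  qed
  then show ?thesis
    using y unfolding s_def y_def[symmetric]
    by (auto simp: scalar_prod_def sum_nonneg_eq_0_iff intro!: eq_vecI)
qed

section \<open>Optimality and the KKT system\<close>

text \<open>The exact second-order Taylor expansion at \<open>x\<close>: symmetry of
  \<open>P\<close> merges the two cross terms into the pairing of the gradient with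
  \<open>d\<close>.\<close>

lemma qp_objective_add:
  assumes P: "P \<in> carrier_mat n n" and sym: "transpose_mat P = P" and q: "q \<in> carrier_vec n"
    and N: "N \<in> carrier_mat n m" and u: "u \<in> carrier_vec m"
    and x: "x \<in> carrier_vec n" and d: "d \<in> carrier_vec n"
  shows "qp_objective P q N u (x + d) =
    qp_objective P q N u x + (P *\<^sub>v x + (q + N *\<^sub>v u)) \<bullet> d + 1 / 2 * (d \<bullet> (P *\<^sub>v d))"
proof -
  have "x \<bullet> (P *\<^sub>v d) = (P *\<^sub>v x) \<bullet> d"
    using transpose_vec_mult_scalar[OF P d x] sym by simp
  moreover have "d \<bullet> (P *\<^sub>v x) = (P *\<^sub>v x) \<bullet> d"
    using P x d by (intro comm_scalar_prod[of _ n]) auto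
  ultimately show ?thesis
    using P q N u x d
    by (simp add: qp_objective_def mult_add_distrib_mat_vec[OF P x d] add_scalar_prod_distrib[of _ n]
          scalar_prod_add_distrib[of _ n] algebra_simps)
qed

lemma kkt_mat_carrier:
  assumes "P \<in> carrier_mat n n" and "A \<in> carrier_mat p n"
  shows "kkt_mat p P A \<in> carrier_mat (n + p) (n + p)"
  using assms by (simp add: kkt_mat_def)

lemma kkt_mat_mult_vec:
  assumes P: "P \<in> carrier_mat n n" and A: "A \<in> carrier_mat p n"
    and x: "x \<in> carrier_vec n" and l: "l \<in> carrier_vec p"
  shows "kkt_mat p P A *\<^sub>v (x @\<^sub>v l) = (P *\<^sub>v x + transpose_mat A *\<^sub>v l) @\<^sub>v (A *\<^sub>v x)"
proof -
  have "kkt_mat p P A *\<^sub>v (x @\<^sub>v l) =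
      (P *\<^sub>v x + transpose_mat A *\<^sub>v l) @\<^sub>v (A *\<^sub>v x + 0\<^sub>m p p *\<^sub>v l)"
    unfolding kkt_mat_def by (rule four_block_mat_mult_vec[of _ n n _ p _ p]) (use assms in auto)
  also have "A *\<^sub>v x + 0\<^sub>m p p *\<^sub>v l = A *\<^sub>v x"
    using A x l by auto
  finally show ?thesis .
qed

text \<open>The first block row of the KKT system is stationarity with multiplier \<open>l\<close>,
  the second is feasibility. Semidefiniteness turns stationarity into global optimality; the left
  inverse \<open>J\<close> supplies the injectivity of the KKT matrix from which uniqueness
  follows.\<close>

lemma qp_solutions_eq_kkt:
  assumes psd: "pos_semidef n P" and q: "q \<in> carrier_vec n"
    and N: "N \<in> carrier_mat n m" and A: "A \<in> carrier_mat p n" and M: "M \<in> carrier_mat p m"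
    and b: "b \<in> carrier_vec p"
    and J: "J \<in> carrier_mat (n + p) (n + p)" and inv: "J * kkt_mat p P A = 1\<^sub>m (n + p)"
    and u: "u \<in> carrier_vec m" and x: "x \<in> carrier_vec n" and l: "l \<in> carrier_vec p"
    and kkt: "kkt_mat p P A *\<^sub>v (x @\<^sub>v l) = (- (q + N *\<^sub>v u)) @\<^sub>v (b - M *\<^sub>v u)"
  shows "qp_solutions n P q N A M b u = {x}"
proof -
  from psd have P: "P \<in> carrier_mat n n" and sym: "transpose_mat P = P"
    and nonneg: "\<And>v. v \<in> carrier_vec n \<Longrightarrow> 0 \<le> v \<bullet> (P *\<^sub>v v)"
    by (auto simp: pos_semidef_def)
  define g where "g = q + N *\<^sub>v u"
  have g: "g \<in> carrier_vec n" using q N u by (simp add: g_def)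
  have "P *\<^sub>v x + transpose_mat A *\<^sub>v l = - g \<and> A *\<^sub>v x = b - M *\<^sub>v u"
    using kkt unfolding kkt_mat_mult_vec[OF P A x l] g_def[symmetric]
    by (subst (asm) append_vec_eq[of _ n]) (use P A x l g in auto)
  then have stat: "P *\<^sub>v x + transpose_mat A *\<^sub>v l = - g" and Ax: "A *\<^sub>v x = b - M *\<^sub>v u"
    by auto
  have feas: "A *\<^sub>v x + M *\<^sub>v u = b"
    using b M u by (auto simp: Ax)
  \<comment> \<open>The gradient at \<open>x\<close> lies in the range of the transpose of
    \<open>A\<close>, hence is orthogonal to the kernel of \<open>A\<close>. This removes the linear
    term of the expansion in \<open>grow\<close>.\<close>
  have "P *\<^sub>v x + g = - (transpose_mat A *\<^sub>v l)"
  proof (rule eq_vecI)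
    fix i assume "i < dim_vec (- (transpose_mat A *\<^sub>v l))"
    then have i: "i < n" using A by simp
    then have "(P *\<^sub>v x + transpose_mat A *\<^sub>v l) $ i = (- g) $ i" by (simp add: stat)
    then show "(P *\<^sub>v x + g) $ i = (- (transpose_mat A *\<^sub>v l)) $ i"
      using i P A g by simp
  qed (use P A g in auto)
  then have grow: "qp_objective P q N u (x + d) = qp_objective P q N u x + 1 / 2 * (d \<bullet> (P *\<^sub>v d))"
    if d: "d \<in> carrier_vec n" and Ad: "A *\<^sub>v d = 0\<^sub>v p" for d
    using qp_objective_add[OF P sym q N u x d] transpose_vec_mult_scalar[OF A d l] A d l Ad
    by (simp add: g_def)
  have dir: "y - x \<in> carrier_vec n" "A *\<^sub>v (y - x) = 0\<^sub>v p" "x + (y - x) = y"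
    if y: "y \<in> carrier_vec n" and fy: "A *\<^sub>v y + M *\<^sub>v u = b" for y
  proof -
    show "y - x \<in> carrier_vec n" using x y by simp
    show "x + (y - x) = y" using x y by auto
    have "A *\<^sub>v y = A *\<^sub>v x"
    proof (rule eq_vecI)
      fix i assume "i < dim_vec (A *\<^sub>v x)"
      then have i: "i < p" using A by simp
      have "(A *\<^sub>v y + M *\<^sub>v u) $ i = (A *\<^sub>v x + M *\<^sub>v u) $ i" by (simp add: fy feas)
      then show "(A *\<^sub>v y) $ i = (A *\<^sub>v x) $ i" using i A M by simp
    qed (use A in auto)
    then show "A *\<^sub>v (y - x) = 0\<^sub>v p"
      using mult_minus_distrib_mat_vec[OF A y x] A x by auto
  qed
  have opt: "qp_objective P q N u x \<le> qp_objective P q N u y"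
    if "y \<in> carrier_vec n" "A *\<^sub>v y + M *\<^sub>v u = b" for y
    using grow[of "y - x"] dir[OF that] nonneg[of "y - x"] by simp
  \<comment> \<open>It suffices that \<open>y\<close> is feasible and no worse than
    \<open>x\<close>; every minimizer is, since it is compared with the feasible point
    \<open>x\<close>.\<close>
  have uniq: "y = x"
    if y: "y \<in> carrier_vec n" and fy: "A *\<^sub>v y + M *\<^sub>v u = b"
      and le: "qp_objective P q N u y \<le> qp_objective P q N u x" for y
  proof -
    define d where "d = y - x"
    have d: "d \<in> carrier_vec n" and Ad: "A *\<^sub>v d = 0\<^sub>v p" and xd: "x + d = y"
      using dir[OF y fy] by (auto simp: d_def)
    have "d \<bullet> (P *\<^sub>v d) = 0" using grow[OF d Ad] nonneg[OF d] le xd by simp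
    then have "P *\<^sub>v d = 0\<^sub>v n" by (rule pos_semidef_quadratic_form_zero[OF psd d])
    \<comment> \<open>Padding \<open>d\<close> with a zero multiplier reduces the two block rows to
      \<open>P d\<close> and \<open>A d\<close>, both zero.\<close>
    then have "kkt_mat p P A *\<^sub>v (d @\<^sub>v 0\<^sub>v p) = 0\<^sub>v n @\<^sub>v 0\<^sub>v p"
      using kkt_mat_mult_vec[OF P A d, of "0\<^sub>v p"] Ad A by auto
    also have "\<dots> = 0\<^sub>v (n + p)" by auto
    finally have "J *\<^sub>v (kkt_mat p P A *\<^sub>v (d @\<^sub>v 0\<^sub>v p)) = 0\<^sub>v (n + p)"
      using J by auto
    moreover have "J *\<^sub>v (kkt_mat p P A *\<^sub>v (d @\<^sub>v 0\<^sub>v p)) = d @\<^sub>v 0\<^sub>v p"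
      using assoc_mult_mat_vec[OF J kkt_mat_carrier[OF P A], of "d @\<^sub>v 0\<^sub>v p"] inv d by simp
    ultimately have "d @\<^sub>v 0\<^sub>v p = 0\<^sub>v n @\<^sub>v 0\<^sub>v p" by auto
    then have "d = 0\<^sub>v n" by (subst (asm) append_vec_eq[of _ n]) (use d in auto)
    then show ?thesis using xd x by simp
  qed
  show ?thesis
    unfolding qp_solutions_def is_arg_min_def
    using x feas opt uniq by (auto simp: not_less)
qed

section \<open>Graphs of affine maps\<close>

text \<open>The map \<open>T\<close> sending u to (u, L u) is linear, and injective because its
  first component is u. Its image therefore has dimension \<open>m\<close>, and the graph of c + L
  is a translate of that image.\<close>

lemma affine_graph_is_affine_subspace:
  fixes c :: "real vec"
  assumes c: "c \<in> carrier_vec n"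
    and L: "\<And>u. u \<in> carrier_vec m \<Longrightarrow> L u \<in> carrier_vec n"
    and L_add: "\<And>u v. u \<in> carrier_vec m \<Longrightarrow> v \<in> carrier_vec m \<Longrightarrow> L (u + v) = L u + L v"
    and L_smult: "\<And>r u. u \<in> carrier_vec m \<Longrightarrow> L (r \<cdot>\<^sub>v u) = r \<cdot>\<^sub>v L u"
  shows "affine_subspace_of_dim class_ring (real_vec_prod m n)
    ((\<lambda>u. (u, c + L u)) ` carrier_vec m) m"
proof -
  let ?K = "class_ring :: real ring" and ?U = "module_vec TYPE(real) m" and ?V = "real_vec_prod m n"
  define T where "T = (\<lambda>u. (u, L u))"
  define W where "W = T ` carrier_vec m"
  interpret U: vec_space "TYPE(real)" m .
  have vsU: "vectorspace ?K ?U" and vsV: "vectorspace ?K ?V"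
    using vec_vs direct_sum_is_vs[OF vec_vs vec_vs] by blast+
  have hom: "T \<in> LinearCombinations.module_hom ?K ?U ?V"
    using L L_add L_smult by (auto simp: T_def LinearCombinations.module_hom_def direct_sum_def module_vec_simps)
  interpret T: linear_map ?K ?U ?V T
    using vsU vsV hom
    by (simp add: linear_map_def mod_hom_def mod_hom_axioms_def vectorspace_def)
  have im: "T.im = W" by (simp add: T.im_def W_def module_vec_simps)
  have sub: "subspace ?K W ?V" using T.imT_is_subspace im by simp
  have vsW: "vectorspace ?K (?V\<lparr>carrier := W\<rparr>)"
    by (rule vectorspace.subspace_is_vs[OF vsV sub])
  \<comment> \<open>With the codomain restricted to its image, \<open>T\<close> becomes bijective,
    so finite dimension and the dimension itself transfer from the domain to
    \<open>W\<close>.\<close>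
  have hom': "T \<in> LinearCombinations.module_hom ?K ?U (?V\<lparr>carrier := W\<rparr>)"
    using hom by (auto simp: LinearCombinations.module_hom_def W_def module_vec_simps)
  interpret T': linear_map ?K ?U "?V\<lparr>carrier := W\<rparr>" T
    using vsU vsW hom'
    by (simp add: linear_map_def mod_hom_def mod_hom_axioms_def vectorspace_def)
  have surj: "T ` carrier ?U = carrier (?V\<lparr>carrier := W\<rparr>)"
    by (simp add: W_def module_vec_simps)
  have inj: "inj_on T (carrier ?U)" by (auto simp: T_def inj_on_def)
  have fin: "vectorspace.fin_dim ?K (?V\<lparr>carrier := W\<rparr>)"
    using T'.surj_fin_dim[OF U.fin_dim surj] .
  have dim: "vectorspace.dim ?K (?V\<lparr>carrier := W\<rparr>) = m"
    using T'.dim_eq[OF U.fin_dim inj surj] U.dim_is_n by simp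
  \<comment> \<open>The base point is the point of the graph over u = 0.\<close>
  have "(\<lambda>u. (u, c + L u)) ` carrier_vec m = (\<lambda>w. (0\<^sub>v m, c) \<oplus>\<^bsub>?V\<^esub> w) ` W"
    unfolding W_def T_def image_image
    by (rule image_cong) (auto simp: direct_sum_def module_vec_simps)
  moreover have "(0\<^sub>v m, c) \<in> carrier ?V"
    using c by (simp add: direct_sum_def module_vec_simps)
  ultimately show ?thesis
    unfolding affine_subspace_of_dim_def using sub fin dim by blast
qed

section \<open>The solution map as an affine function of the input\<close>

lemma vec_first_add:
  assumes "v \<in> carrier_vec (n + p)" and "w \<in> carrier_vec (n + p)"
  shows "vec_first (v + w) n = vec_first v n + vec_first w n"
  using assms by (auto simp: vec_first_def)

lemma vec_first_smult:
  assumes "v \<in> carrier_vec (n + p)"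
  shows "vec_first (r \<cdot>\<^sub>v v) n = r \<cdot>\<^sub>v vec_first v n"
  using assms by (auto simp: vec_first_def)

theorem lemma1:
  fixes n m p :: nat
    and P N A M :: "real mat"
    and q b :: "real vec"
  assumes "n \<ge> 1" and "m \<ge> 1"
    and "P \<in> carrier_mat n n" and "transpose_mat P = P"
    and "q \<in> carrier_vec n"
    and "N \<in> carrier_mat n m"
    and "A \<in> carrier_mat p n"
    and "M \<in> carrier_mat p m"
    and "b \<in> carrier_vec p"
    and "pos_semidef n P"
    and "invertible_mat (kkt_mat p P A)"
  shows "affine_subspace_of_dim class_ring (real_vec_prod m n) (qp_behavior m n P q N A M b) m"
proof -
  note P = assms(3) and q = assms(5) and N = assms(6) and A = assms(7) and M = assms(8)
    and b = assms(9) and psd = assms(10)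
  let ?K = "kkt_mat p P A"
  have K: "?K \<in> carrier_mat (n + p) (n + p)" by (rule kkt_mat_carrier[OF P A])
  obtain J where KJ: "?K * J = 1\<^sub>m (n + p)" and JK: "J * ?K = 1\<^sub>m (dim_row J)"
    using assms(11) K by (auto simp: invertible_mat_def inverts_mat_def)
  \<comment> \<open>Invertibility yields \<open>J\<close> without its size; comparing column counts
    in the two inverse identities recovers it.\<close>
  have "dim_col J = n + p" using arg_cong[OF KJ, of dim_col] by simp
  moreover have "dim_row J = n + p" using arg_cong[OF JK, of dim_col] K by simp
  ultimately have J: "J \<in> carrier_mat (n + p) (n + p)" and JK: "J * ?K = 1\<^sub>m (n + p)"
    using JK by auto
  \<comment> \<open>\<open>G v w\<close> is the decision part of the KKT solution with right-hand
    side (v, w), and is jointly linear in both. The actual right-hand side splits as (-q, b) + (-N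
    u, -M u), giving the constant \<open>c\<close> and the linear part \<open>L\<close>.\<close>
  define G where "G = (\<lambda>v w. vec_first (J *\<^sub>v (v @\<^sub>v w)) n)"
  define c where "c = G (- q) b"
  define L where "L = (\<lambda>u. G (- (N *\<^sub>v u)) (- (M *\<^sub>v u)))"
  have G_add: "G (v + v') (w + w') = G v w + G v' w'"
    if "v \<in> carrier_vec n" "v' \<in> carrier_vec n" "w \<in> carrier_vec p" "w' \<in> carrier_vec p" for v v' w w'
    using that J unfolding G_def append_vec_add[OF that, symmetric]
    by (simp add: mult_add_distrib_mat_vec[OF J] vec_first_add[of _ n p])
  have G_smult: "G (r \<cdot>\<^sub>v v) (r \<cdot>\<^sub>v w) = r \<cdot>\<^sub>v G v w"
    if v: "v \<in> carrier_vec n" and w: "w \<in> carrier_vec p" for r v w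
  proof -
    have "(r \<cdot>\<^sub>v v) @\<^sub>v (r \<cdot>\<^sub>v w) = r \<cdot>\<^sub>v (v @\<^sub>v w)" using v w by auto
    then show ?thesis
      using v w J by (simp add: G_def mult_mat_vec[OF J] vec_first_smult[of _ n p])
  qed
  have G_carrier: "G v w \<in> carrier_vec n" for v w by (simp add: G_def)
  have sol: "qp_solutions n P q N A M b u = {c + L u}" if u: "u \<in> carrier_vec m" for u
  proof -
    let ?r = "(- (q + N *\<^sub>v u)) @\<^sub>v (b - M *\<^sub>v u)"
    define z where "z = J *\<^sub>v ?r"
    have r: "?r \<in> carrier_vec (n + p)" using q N b M u by auto
    have z: "z \<in> carrier_vec (n + p)" using J r by (simp add: z_def)
    have split: "vec_first z n @\<^sub>v vec_last z p = z" using z by simp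
    \<comment> \<open>The right inverse property of \<open>J\<close> gives existence of a KKT point;
      the last \<open>p\<close> entries of \<open>z\<close> are its multiplier.\<close>
    have "?K *\<^sub>v z = ?r"
      unfolding z_def using assoc_mult_mat_vec[OF K J r] KJ r by simp
    then have "qp_solutions n P q N A M b u = {vec_first z n}"
      by (intro qp_solutions_eq_kkt[OF psd q N A M b J JK u, of _ "vec_last z p"]) (simp_all add: split)
    moreover have "vec_first z n = c + L u"
    proof -
      have "- (q + N *\<^sub>v u) = - q + - (N *\<^sub>v u)" "b - M *\<^sub>v u = b + - (M *\<^sub>v u)"
        using q N b M u by auto
      then have "vec_first z n = G (- q + - (N *\<^sub>v u)) (b + - (M *\<^sub>v u))"
        by (simp add: z_def G_def)
      then show ?thesis
        using G_add[of "- q" "- (N *\<^sub>v u)" b "- (M *\<^sub>v u)"] q N b M u by (simp add: c_def L_def)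
    qed
    ultimately show ?thesis by simp
  qed
  have c: "c \<in> carrier_vec n" and L: "\<And>u. L u \<in> carrier_vec n"
    by (simp_all add: c_def L_def G_carrier)
  have L_add: "L (u + v) = L u + L v" if u: "u \<in> carrier_vec m" and v: "v \<in> carrier_vec m" for u v
  proof -
    have "- (N *\<^sub>v (u + v)) = - (N *\<^sub>v u) + - (N *\<^sub>v v)"
      "- (M *\<^sub>v (u + v)) = - (M *\<^sub>v u) + - (M *\<^sub>v v)"
      using N M u v mult_add_distrib_mat_vec[OF N u v] mult_add_distrib_mat_vec[OF M u v] by auto
    then show ?thesis using G_add N M u v by (simp add: L_def)
  qed
  have L_smult: "L (r \<cdot>\<^sub>v u) = r \<cdot>\<^sub>v L u" if u: "u \<in> carrier_vec m" for r u
  proof -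
    have "- (N *\<^sub>v (r \<cdot>\<^sub>v u)) = r \<cdot>\<^sub>v (- (N *\<^sub>v u))" "- (M *\<^sub>v (r \<cdot>\<^sub>v u)) = r \<cdot>\<^sub>v (- (M *\<^sub>v u))"
      using mult_mat_vec[OF N u] mult_mat_vec[OF M u] by auto
    then show ?thesis using G_smult N M u by (simp add: L_def)
  qed
  \<comment> \<open>Every solution set is a singleton, so the behavior is the graph of a function
    defined for all inputs.\<close>
  have "qp_behavior m n P q N A M b = (\<lambda>u. (u, c + L u)) ` carrier_vec m"
    using sol c L by (auto simp: qp_behavior_def)
  then show ?thesis
    using affine_graph_is_affine_subspace[of c n m L] c L L_add L_smult by simp
qed

end
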